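(* Let $n\ge1$, $D_n=\langle a,b\mid a^n=b^2=1,\ bab=a^{-1}\rangle$, and $S\subseteq D_n\setminus\{1\}$ with $S=S^{-1}$. Let $m=2$ if $n$ is odd and $m=4$ if $n$ is even. Then the spectrum of the Cayley graph $X(D_n,S)$ is $\{[\lambda_i]^1;\ [\mu_{h1}]^2,[\mu_{h2}]^2 \mid i=1,\dots,m;\ h=1,\dots,\lfloor\frac{n-1}{2}\rfloor\}$ (exponents denote multiplicities), where $\lambda_i=\sum_{s\in S}\psi_i(s)$ for $i=1,\dots,m$, and for each $1\le h\le\lfloor\frac{n-1}{2}\rfloor$ the numbers $\mu_{h1},\mu_{h2}$ satisfy $\mu_{h1}+\mu_{h2}=\sum_{s\in S}\chi_h(s)$ and $\mu_{h1}^2+\mu_{h2}^2=\sum_{s_1,s_2\in S}\chi_h(s_1s_2)$.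
   Context: The Cayley graph $X(G,S)$ has vertex set $G$, $x,y$ adjacent iff $x^{-1}y\in S$; its spectrum is the multiset of eigenvalues of its adjacency matrix. The characters of $D_n$: $\psi_1(a^k)=\psi_1(ba^k)=1$; $\psi_2(a^k)=1$, $\psi_2(ba^k)=-1$; for even $n$ additionally $\psi_3(a^k)=\psi_3(ba^k)=(-1)^k$ and $\psi_4(a^k)=(-1)^k$, $\psi_4(ba^k)=(-1)^{k+1}$; and for $1\le h\le\lfloor\frac{n-1}{2}\rfloor$, $\chi_h(a^k)=2\cos(\frac{2kh\pi}{n})$, $\chi_h(ba^k)=0$. *)

theory Defs
  imports
    "HOL-Algebra.Coset"
    "Jordan_Normal_Form.Char_Poly"
    "Graph_Theory.Pair_Digraph"
begin

section \<open>Groups given by generators and relations\<close>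

text \<open>A letter \<open>(x, False)\<close> stands for the generator \<open>x\<close> and \<open>(x, True)\<close> for its formal
  inverse. The generators are all elements of the type \<open>'g\<close>; a relation \<open>u = v\<close> is the pair
  \<open>(u, v)\<close> of words.\<close>

type_synonym 'g word = "('g \<times> bool) list"

inductive pres_eq :: "('g word \<times> 'g word) set \<Rightarrow> 'g word \<Rightarrow> 'g word \<Rightarrow> bool" for R where
  refl: "pres_eq R u u"
| sym: "pres_eq R u v \<Longrightarrow> pres_eq R v u"
| trans: "pres_eq R u v \<Longrightarrow> pres_eq R v w \<Longrightarrow> pres_eq R u w"
| append: "pres_eq R u u' \<Longrightarrow> pres_eq R v v' \<Longrightarrow> pres_eq R (u @ v) (u' @ v')"
| cancel: "pres_eq R [(x, e), (x, \<not> e)] []"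
| relation: "(u, v) \<in> R \<Longrightarrow> pres_eq R u v"

definition pres_class :: "('g word \<times> 'g word) set \<Rightarrow> 'g word \<Rightarrow> 'g word set" where
  "pres_class R u = {v. pres_eq R u v}"

definition presented_group :: "('g word \<times> 'g word) set \<Rightarrow> 'g word set monoid" where
  "presented_group R =
    \<lparr>carrier = range (pres_class R),
     monoid.mult = (\<lambda>A B. \<Union>u\<in>A. \<Union>v\<in>B. pres_class R (u @ v)),
     one = pres_class R []\<rparr>"

lemma pres_class_eq_iff: "pres_class R u = pres_class R v \<longleftrightarrow> pres_eq R u v"
  unfolding pres_class_def set_eq_iff mem_Collect_eq
  by (meson pres_eq.refl pres_eq.sym pres_eq.trans)

lemma pres_class_mult:
  "pres_class R u \<otimes>\<^bsub>presented_group R\<^esub> pres_class R v = pres_class R (u @ v)"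
proof -
  have "pres_class R (u' @ v') = pres_class R (u @ v)"
    if "u' \<in> pres_class R u" "v' \<in> pres_class R v" for u' v'
  proof -
    have "pres_eq R u u'" "pres_eq R v v'"
      using that by (simp_all add: pres_class_def)
    then show ?thesis
      unfolding pres_class_eq_iff by (intro pres_eq.sym[OF pres_eq.append])
  qed
  moreover have "u \<in> pres_class R u" "v \<in> pres_class R v"
    by (simp_all add: pres_class_def pres_eq.refl)
  ultimately have "(\<Union>u'\<in>pres_class R u. \<Union>v'\<in>pres_class R v. pres_class R (u' @ v'))
      = pres_class R (u @ v)"
    by blast
  then show ?thesis
    by (simp add: presented_group_def)
qed

lemma presented_group_carrier: "carrier (presented_group R) = range (pres_class R)"
  and presented_group_one: "\<one>\<^bsub>presented_group R\<^esub> = pres_class R []"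
  by (simp_all add: presented_group_def)

lemma pres_eq_inverse:
  "pres_eq R (map (\<lambda>(x, e). (x, \<not> e)) (rev w) @ w) []"
proof (induction w)
  case Nil
  then show ?case by (simp add: pres_eq.refl)
next
  case (Cons l w)
  obtain x e where l: "l = (x, e)" by (cases l)
  let ?w' = "map (\<lambda>(x, e). (x, \<not> e)) (rev w)"
  have "pres_eq R ([(x, \<not> e), (x, e)] @ w) ([] @ w)"
    using pres_eq.cancel[of R x "\<not> e"] pres_eq.refl[of R w] by (intro pres_eq.append) auto
  then have "pres_eq R (?w' @ ([(x, \<not> e), (x, e)] @ w)) (?w' @ ([] @ w))"
    by (rule pres_eq.append[OF pres_eq.refl])
  then have "pres_eq R (map (\<lambda>(x, e). (x, \<not> e)) (rev (l # w)) @ l # w) (?w' @ w)"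
    by (simp add: l)
  then show ?case using Cons by (rule pres_eq.trans)
qed

lemma group_presented_group: "group (presented_group R)"
proof (rule groupI)
  fix x assume "x \<in> carrier (presented_group R)"
  then obtain w where w: "x = pres_class R w" by (auto simp: presented_group_carrier)
  show "\<exists>y\<in>carrier (presented_group R). y \<otimes>\<^bsub>presented_group R\<^esub> x = \<one>\<^bsub>presented_group R\<^esub>"
    by (rule bexI[of _ "pres_class R (map (\<lambda>(x, e). (x, \<not> e)) (rev w))"])
       (auto simp: w pres_class_mult presented_group_one presented_group_carrier
             pres_class_eq_iff pres_eq_inverse)
qed (auto simp: presented_group_carrier presented_group_one pres_class_mult)

primrec word_eval :: "('c, 'm) monoid_scheme \<Rightarrow> ('g \<Rightarrow> 'c) \<Rightarrow> 'g word \<Rightarrow> 'c" where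
  "word_eval H f [] = \<one>\<^bsub>H\<^esub>"
| "word_eval H f (l # w) =
    (if snd l then inv\<^bsub>H\<^esub> f (fst l) else f (fst l)) \<otimes>\<^bsub>H\<^esub> word_eval H f w"

context group
begin

lemma word_eval_closed: "range f \<subseteq> carrier G \<Longrightarrow> word_eval G f w \<in> carrier G"
  by (induction w) auto

lemma word_eval_append:
  assumes "range f \<subseteq> carrier G"
  shows "word_eval G f (u @ v) = word_eval G f u \<otimes> word_eval G f v"
proof -
  have "f x \<in> carrier G" for x using assms by auto
  then show ?thesis by (induction u) (auto simp: word_eval_closed[OF assms] m_assoc)
qed

lemma word_eval_pres_eq:
  assumes f: "range f \<subseteq> carrier G"
    and R: "\<And>u v. (u, v) \<in> R \<Longrightarrow> word_eval G f u = word_eval G f v"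
    and "pres_eq R u v"
  shows "word_eval G f u = word_eval G f v"
  using assms(3)
proof (induction rule: pres_eq.induct)
  case (cancel x e)
  have "f x \<in> carrier G" using f by auto
  then show ?case by (cases e) auto
qed (auto simp: R word_eval_append[OF f])

text \<open>Together with the fact that the classes of the generators generate \<open>presented_group R\<close>, this
  is its universal property.\<close>

lemma presented_group_universal:
  assumes f: "range f \<subseteq> carrier G"
    and R: "\<And>u v. (u, v) \<in> R \<Longrightarrow> word_eval G f u = word_eval G f v"
  shows "\<exists>h \<in> hom (presented_group R) G. \<forall>w. h (pres_class R w) = word_eval G f w"
proof -
  define h where "h A = word_eval G f (SOME w. w \<in> A)" for A
  have h: "h (pres_class R w) = word_eval G f w" for w
  proof -
    have "w \<in> pres_class R w" by (simp add: pres_class_def pres_eq.refl)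
    then have "(SOME v. v \<in> pres_class R w) \<in> pres_class R w" by (rule someI)
    then have "pres_eq R w (SOME v. v \<in> pres_class R w)" by (simp add: pres_class_def)
    from word_eval_pres_eq[OF f R this] show ?thesis by (simp only: h_def)
  qed
  have "h \<in> hom (presented_group R) G"
    by (rule homI)
       (auto simp: presented_group_carrier h pres_class_mult word_eval_closed[OF f] word_eval_append[OF f])
  with h show ?thesis by auto
qed

end


section \<open>The dihedral group\<close>

datatype dihedral_gen = Gen_a | Gen_b

definition dihedral_relations :: "nat \<Rightarrow> (dihedral_gen word \<times> dihedral_gen word) set" where
  "dihedral_relations n =
    {(replicate n (Gen_a, False), []),
     ([(Gen_b, False), (Gen_b, False)], []),
     ([(Gen_b, False), (Gen_a, False), (Gen_b, False)], [(Gen_a, True)])}"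

definition dihedral_group :: "nat \<Rightarrow> dihedral_gen word set monoid" where
  "dihedral_group n = presented_group (dihedral_relations n)"

definition dih_a :: "nat \<Rightarrow> dihedral_gen word set" where
  "dih_a n = pres_class (dihedral_relations n) [(Gen_a, False)]"

definition dih_b :: "nat \<Rightarrow> dihedral_gen word set" where
  "dih_b n = pres_class (dihedral_relations n) [(Gen_b, False)]"

definition dih_rot :: "nat \<Rightarrow> nat \<Rightarrow> dihedral_gen word set" where
  "dih_rot n k = dih_a n [^]\<^bsub>dihedral_group n\<^esub> k"

definition dih_refl :: "nat \<Rightarrow> nat \<Rightarrow> dihedral_gen word set" where
  "dih_refl n k = dih_b n \<otimes>\<^bsub>dihedral_group n\<^esub> dih_a n [^]\<^bsub>dihedral_group n\<^esub> k"

text \<open>The function with value \<open>f k\<close> at \<open>a\<^sup>k\<close> and \<open>g k\<close> at \<open>b a\<^sup>k\<close>. It is well defined on all of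
  the group if \<open>f\<close> and \<open>g\<close> have period \<open>n \<ge> 1\<close> (lemma \<open>dih_fun_rot_refl\<close> below); the least
  exponent is only a choice of representative.\<close>

definition dih_fun :: "nat \<Rightarrow> (nat \<Rightarrow> 'c) \<Rightarrow> (nat \<Rightarrow> 'c) \<Rightarrow> dihedral_gen word set \<Rightarrow> 'c" where
  "dih_fun n f g x =
    (if \<exists>k. x = dih_rot n k then f (LEAST k. x = dih_rot n k)
     else g (LEAST k. x = dih_refl n k))"

text \<open>\<open>dih_psi n 3\<close> and \<open>dih_psi n 4\<close> are characters only for even \<open>n\<close>.\<close>

definition dih_psi :: "nat \<Rightarrow> nat \<Rightarrow> dihedral_gen word set \<Rightarrow> complex" where
  "dih_psi n i =
    (if i = 1 then dih_fun n (\<lambda>k. 1) (\<lambda>k. 1)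
     else if i = 2 then dih_fun n (\<lambda>k. 1) (\<lambda>k. - 1)
     else if i = 3 then dih_fun n (\<lambda>k. (- 1) ^ k) (\<lambda>k. (- 1) ^ k)
     else dih_fun n (\<lambda>k. (- 1) ^ k) (\<lambda>k. (- 1) ^ (k + 1)))"

definition dih_chi :: "nat \<Rightarrow> nat \<Rightarrow> dihedral_gen word set \<Rightarrow> complex" where
  "dih_chi n h =
    dih_fun n (\<lambda>k. complex_of_real (2 * cos (2 * real k * real h * pi / real n))) (\<lambda>k. 0)"

lemma group_dihedral_group: "group (dihedral_group n)"
  unfolding dihedral_group_def by (rule group_presented_group)

lemma dih_a_closed: "dih_a n \<in> carrier (dihedral_group n)"
  and dih_b_closed: "dih_b n \<in> carrier (dihedral_group n)"
  by (auto simp: dih_a_def dih_b_def dihedral_group_def presented_group_carrier)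

lemma dih_rot_class: "dih_rot n k = pres_class (dihedral_relations n) (replicate k (Gen_a, False))"
proof (induction k)
  case 0
  interpret group "dihedral_group n" by (rule group_dihedral_group)
  show ?case by (simp add: dih_rot_def) (simp add: dihedral_group_def presented_group_one)
next
  case (Suc k)
  interpret group "dihedral_group n" by (rule group_dihedral_group)
  have "dih_rot n (Suc k) = dih_rot n k \<otimes>\<^bsub>dihedral_group n\<^esub> dih_a n"
    by (simp add: dih_rot_def)
  also have "\<dots> = pres_class (dihedral_relations n) (replicate k (Gen_a, False) @ [(Gen_a, False)])"
    unfolding Suc dih_a_def dihedral_group_def pres_class_mult ..
  finally show ?case by (simp add: replicate_append_same)
qed

lemma dih_refl_class:
  "dih_refl n k = pres_class (dihedral_relations n) ((Gen_b, False) # replicate k (Gen_a, False))"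
  using dih_rot_class[of n k] unfolding dih_refl_def dih_rot_def
  by (simp add: dih_b_def dihedral_group_def pres_class_mult)

lemma dih_a_pow: "dih_a n [^]\<^bsub>dihedral_group n\<^esub> n = \<one>\<^bsub>dihedral_group n\<^esub>"
proof -
  have "pres_eq (dihedral_relations n) (replicate n (Gen_a, False)) []"
    by (rule pres_eq.relation) (simp add: dihedral_relations_def)
  then show ?thesis
    using dih_rot_class[of n n]
    by (simp add: dih_rot_def dihedral_group_def presented_group_one pres_class_eq_iff)
qed

lemma dih_b_square: "dih_b n \<otimes>\<^bsub>dihedral_group n\<^esub> dih_b n = \<one>\<^bsub>dihedral_group n\<^esub>"
  unfolding dih_b_def dihedral_group_def pres_class_mult presented_group_one pres_class_eq_iff
  by (rule pres_eq.relation) (simp add: dihedral_relations_def)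

lemma pres_class_inverse:
  "pres_class R [(x, True)] = inv\<^bsub>presented_group R\<^esub> pres_class R [(x, False)]"
proof -
  interpret group "presented_group R" by (rule group_presented_group)
  have "pres_eq R ([(x, True)] @ [(x, False)]) []"
    using pres_eq.cancel[of R x True] by simp
  then have "pres_class R [(x, True)] \<otimes>\<^bsub>presented_group R\<^esub> pres_class R [(x, False)]
      = \<one>\<^bsub>presented_group R\<^esub>"
    unfolding pres_class_mult presented_group_one pres_class_eq_iff .
  then show ?thesis
    by (intro inv_equality[symmetric]) (auto simp: presented_group_carrier)
qed

lemma dih_bab:
  "dih_b n \<otimes>\<^bsub>dihedral_group n\<^esub> dih_a n \<otimes>\<^bsub>dihedral_group n\<^esub> dih_b n = inv\<^bsub>dihedral_group n\<^esub> dih_a n"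
  unfolding dih_a_def dih_b_def dihedral_group_def pres_class_inverse[symmetric] pres_class_mult
    pres_class_eq_iff
  by (rule pres_eq.relation) (simp add: dihedral_relations_def)

text \<open>A concrete model, used to see that the normal forms \<open>a\<^sup>k\<close> and \<open>b a\<^sup>k\<close> with \<open>k < n\<close> are
  pairwise distinct: \<open>(s, k)\<close> represents \<open>a\<^sup>k\<close> or \<open>b a\<^sup>k\<close>.\<close>

definition dih_model :: "nat \<Rightarrow> (bool \<times> int) monoid" where
  "dih_model n =
    \<lparr>carrier = UNIV \<times> {0..<int n},
     monoid.mult = (\<lambda>(s, j) (t, k). (s \<noteq> t, ((if t then - j else j) + k) mod int n)),
     one = (False, 0)\<rparr>"

lemma group_dih_model:
  assumes "n \<ge> 1"
  shows "group (dih_model n)"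
proof (rule groupI)
  fix x assume x: "x \<in> carrier (dih_model n)"
  obtain s j where sj: "x = (s, j)" by (cases x)
  show "\<exists>y\<in>carrier (dih_model n). y \<otimes>\<^bsub>dih_model n\<^esub> x = \<one>\<^bsub>dih_model n\<^esub>"
    by (rule bexI[of _ "(s, (if s then j else - j) mod int n)"])
       (use x assms in \<open>auto simp: sj dih_model_def mod_simps\<close>)
qed (use assms in \<open>auto simp: dih_model_def mod_simps algebra_simps\<close>)

lemma dih_model_hom:
  assumes "n \<ge> 1"
  shows "\<exists>h. \<forall>k. h (dih_rot n k) = (False, int k mod int n) \<and> h (dih_refl n k) = (True, int k mod int n)"
proof -
  let ?H = "dih_model n"
  interpret H: group ?H by (rule group_dih_model[OF assms])
  define f where "f g = (case g of Gen_a \<Rightarrow> (False, 1 mod int n) | Gen_b \<Rightarrow> (True, 0))" for g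
  have f: "range f \<subseteq> carrier ?H"
    using assms by (auto simp: f_def dih_model_def split: dihedral_gen.splits)
  have rep: "word_eval ?H f (replicate k (Gen_a, False)) = (False, int k mod int n)" for k
    by (induction k) (auto simp: f_def dih_model_def mod_simps)
  have inv_a: "inv\<^bsub>?H\<^esub> (f Gen_a) = (False, - 1 mod int n)"
    using assms by (intro H.inv_equality) (auto simp: f_def dih_model_def mod_simps)
  have R: "word_eval ?H f u = word_eval ?H f v" if "(u, v) \<in> dihedral_relations n" for u v
    using that rep[of n] inv_a
    by (auto simp: dihedral_relations_def) (auto simp: f_def dih_model_def mod_simps)
  obtain h where h: "\<And>w. h (pres_class (dihedral_relations n) w) = word_eval ?H f w"
    using H.presented_group_universal[OF f R] by blast
  have "h (dih_rot n k) = (False, int k mod int n)" for k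
    by (simp add: dih_rot_class h rep)
  moreover have "h (dih_refl n k) = (True, int k mod int n)" for k
    by (simp add: dih_refl_class h rep) (simp add: f_def dih_model_def)
  ultimately show ?thesis by blast
qed

lemma dih_rot_mod: "dih_rot n (k mod n) = dih_rot n k"
  and dih_refl_mod: "dih_refl n (k mod n) = dih_refl n k"
proof -
  interpret group "dihedral_group n" by (rule group_dihedral_group)
  have "dih_a n [^]\<^bsub>dihedral_group n\<^esub> k
      = dih_a n [^]\<^bsub>dihedral_group n\<^esub> (n * (k div n)) \<otimes>\<^bsub>dihedral_group n\<^esub> dih_a n [^]\<^bsub>dihedral_group n\<^esub> (k mod n)"
    by (simp add: nat_pow_mult dih_a_closed)
  then have *: "dih_a n [^]\<^bsub>dihedral_group n\<^esub> (k mod n) = dih_a n [^]\<^bsub>dihedral_group n\<^esub> k"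
    by (simp add: nat_pow_pow[symmetric] dih_a_closed dih_a_pow nat_pow_one)
  show "dih_rot n (k mod n) = dih_rot n k" "dih_refl n (k mod n) = dih_refl n k"
    unfolding dih_rot_def dih_refl_def * by simp_all
qed

lemma dih_rot_eq_iff: "n \<ge> 1 \<Longrightarrow> dih_rot n j = dih_rot n k \<longleftrightarrow> j mod n = k mod n"
  and dih_refl_eq_iff: "n \<ge> 1 \<Longrightarrow> dih_refl n j = dih_refl n k \<longleftrightarrow> j mod n = k mod n"
  and dih_rot_neq_refl: "n \<ge> 1 \<Longrightarrow> dih_rot n j \<noteq> dih_refl n k"
proof -
  assume "n \<ge> 1"
  then obtain h where h: "\<And>k. h (dih_rot n k) = (False, int k mod int n)"
    "\<And>k. h (dih_refl n k) = (True, int k mod int n)"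
    using dih_model_hom by blast
  show "dih_rot n j = dih_rot n k \<longleftrightarrow> j mod n = k mod n"
    using h(1)[of j] h(1)[of k] dih_rot_mod[of n j] dih_rot_mod[of n k]
    by (metis nat_int of_nat_mod prod.inject)
  show "dih_refl n j = dih_refl n k \<longleftrightarrow> j mod n = k mod n"
    using h(2)[of j] h(2)[of k] dih_refl_mod[of n j] dih_refl_mod[of n k]
    by (metis nat_int of_nat_mod prod.inject)
  show "dih_rot n j \<noteq> dih_refl n k"
    using h(1)[of j] h(2)[of k] by auto
qed

lemma dihedral_group_carrier:
  assumes "n \<ge> 1"
  shows "carrier (dihedral_group n) = dih_rot n ` {..<n} \<union> dih_refl n ` {..<n}"
proof
  let ?D = "dihedral_group n" and ?a = "dih_a n" and ?b = "dih_b n"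
  interpret group ?D by (rule group_dihedral_group)
  note cl = dih_a_closed[of n] dih_b_closed[of n]
  have in_range: "dih_rot n k \<in> dih_rot n ` {..<n}" "dih_refl n k \<in> dih_refl n ` {..<n}" for k
    using assms dih_rot_mod[of n k] dih_refl_mod[of n k]
    by (metis imageI lessThan_iff mod_less_divisor less_eq_Suc_le One_nat_def)+
  have inv_a: "inv\<^bsub>?D\<^esub> ?a = ?a [^]\<^bsub>?D\<^esub> (n - 1)"
  proof (rule inv_equality)
    have "?a [^]\<^bsub>?D\<^esub> (n - 1) \<otimes>\<^bsub>?D\<^esub> ?a = ?a [^]\<^bsub>?D\<^esub> (Suc (n - 1))" by simp
    then show "?a [^]\<^bsub>?D\<^esub> (n - 1) \<otimes>\<^bsub>?D\<^esub> ?a = \<one>\<^bsub>?D\<^esub>"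
      using assms dih_a_pow[of n] by simp
  qed (simp_all add: cl)
  have inv_b: "inv\<^bsub>?D\<^esub> ?b = ?b"
    by (rule inv_equality) (simp_all add: cl dih_b_square)
  have ab: "?a \<otimes>\<^bsub>?D\<^esub> ?b = ?b \<otimes>\<^bsub>?D\<^esub> ?a [^]\<^bsub>?D\<^esub> (n - 1)"
  proof -
    have "?b \<otimes>\<^bsub>?D\<^esub> (?b \<otimes>\<^bsub>?D\<^esub> ?a \<otimes>\<^bsub>?D\<^esub> ?b) = ?a \<otimes>\<^bsub>?D\<^esub> ?b"
      using cl by (simp add: m_assoc[symmetric] dih_b_square)
    then show ?thesis by (simp add: dih_bab inv_a)
  qed
  have a_rot: "?a \<otimes>\<^bsub>?D\<^esub> dih_rot n k = dih_rot n (Suc k)" for k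
    unfolding dih_rot_def by (rule nat_pow_Suc2[OF cl(1), symmetric])
  have a_refl: "?a \<otimes>\<^bsub>?D\<^esub> dih_refl n k = dih_refl n (n - 1 + k)" for k
    using cl unfolding dih_refl_def
    by (simp add: m_assoc[symmetric] ab) (simp add: m_assoc nat_pow_mult)
  have b_rot: "?b \<otimes>\<^bsub>?D\<^esub> dih_rot n k = dih_refl n k" for k
    by (simp add: dih_rot_def dih_refl_def)
  have b_refl: "?b \<otimes>\<^bsub>?D\<^esub> dih_refl n k = dih_rot n k" for k
    using cl by (simp add: dih_rot_def dih_refl_def m_assoc[symmetric] dih_b_square)
  define N where "N = range (dih_rot n) \<union> range (dih_refl n)"
  have aN: "?a \<otimes>\<^bsub>?D\<^esub> y \<in> N" and bN: "?b \<otimes>\<^bsub>?D\<^esub> y \<in> N" if "y \<in> N" for y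
    using that by (auto simp: N_def a_rot a_refl b_rot b_refl)
  have N_carrier: "N \<subseteq> carrier ?D"
    using cl by (auto simp: N_def dih_rot_def dih_refl_def)
  have apN: "?a [^]\<^bsub>?D\<^esub> (k::nat) \<otimes>\<^bsub>?D\<^esub> y \<in> N" if "y \<in> N" for k y
    using that
  proof (induction k arbitrary: y)
    case 0
    then show ?case using N_carrier by auto
  next
    case (Suc k)
    then show ?case using Suc.IH[OF aN[OF Suc.prems]] cl N_carrier by (auto simp: m_assoc)
  qed
  have "pres_class (dihedral_relations n) w \<in> N" for w
  proof (induction w)
    case Nil
    have "pres_class (dihedral_relations n) [] = dih_rot n 0" by (simp add: dih_rot_class)
    then show ?case by (simp add: N_def)
  next
    case (Cons l w)
    let ?c = "pres_class (dihedral_relations n)"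
    have split: "?c (l # w) = ?c [l] \<otimes>\<^bsub>?D\<^esub> ?c w"
      by (simp add: dihedral_group_def pres_class_mult)
    obtain x e where l: "l = (x, e)" by (cases l)
    have "?c [l] = ?a \<or> ?c [l] = ?a [^]\<^bsub>?D\<^esub> (n - 1) \<or> ?c [l] = ?b"
    proof (cases e)
      case True
      have "?c [l] = inv\<^bsub>?D\<^esub> (?c [(x, False)])"
        using True by (simp add: l pres_class_inverse dihedral_group_def)
      then show ?thesis
        by (cases x) (auto simp: dih_a_def[symmetric] dih_b_def[symmetric] inv_a inv_b)
    next
      case False
      then show ?thesis by (cases x) (auto simp: l dih_a_def dih_b_def)
    qed
    then show ?case using Cons aN bN apN unfolding split by metis
  qed
  then have "carrier ?D \<subseteq> N"
    unfolding dihedral_group_def presented_group_carrier by blast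
  also have "N \<subseteq> dih_rot n ` {..<n} \<union> dih_refl n ` {..<n}"
    using in_range unfolding N_def by blast
  finally show "carrier ?D \<subseteq> dih_rot n ` {..<n} \<union> dih_refl n ` {..<n}" .
  show "dih_rot n ` {..<n} \<union> dih_refl n ` {..<n} \<subseteq> carrier ?D"
    using N_carrier by (auto simp: N_def)
qed

lemma finite_dihedral_group: "n \<ge> 1 \<Longrightarrow> finite (carrier (dihedral_group n))"
  by (simp add: dihedral_group_carrier)

lemma card_dihedral_group:
  assumes "n \<ge> 1"
  shows "card (carrier (dihedral_group n)) = 2 * n"
proof -
  have "inj_on (dih_rot n) {..<n}" "inj_on (dih_refl n) {..<n}"
    using assms by (auto simp: inj_on_def dih_rot_eq_iff dih_refl_eq_iff)
  moreover have "dih_rot n ` {..<n} \<inter> dih_refl n ` {..<n} = {}"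
    using assms by (auto simp: dih_rot_neq_refl)
  ultimately show ?thesis
    by (simp add: dihedral_group_carrier[OF assms] card_Un_disjoint card_image)
qed

lemma dih_fun_rot_refl:
  assumes "n \<ge> 1" and f: "\<And>k. f (k mod n) = f k" and g: "\<And>k. g (k mod n) = g k"
  shows "dih_fun n f g (dih_rot n k) = f k" and "dih_fun n f g (dih_refl n k) = g k"
proof -
  have "dih_rot n k = dih_rot n (LEAST j. dih_rot n k = dih_rot n j)"
    by (rule LeastI[of _ k]) simp
  then have "k mod n = (LEAST j. dih_rot n k = dih_rot n j) mod n"
    by (simp only: dih_rot_eq_iff[OF assms(1)])
  then show "dih_fun n f g (dih_rot n k) = f k"
    unfolding dih_fun_def using f by (metis (mono_tags, lifting))
  have "dih_refl n k = dih_refl n (LEAST j. dih_refl n k = dih_refl n j)"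
    by (rule LeastI[of _ k]) simp
  then have "k mod n = (LEAST j. dih_refl n k = dih_refl n j) mod n"
    by (simp only: dih_refl_eq_iff[OF assms(1)])
  moreover have "\<not> (\<exists>j. dih_refl n k = dih_rot n j)"
    using dih_rot_neq_refl[OF assms(1)] by metis
  ultimately show "dih_fun n f g (dih_refl n k) = g k"
    unfolding dih_fun_def using g by (metis (mono_tags, lifting))
qed

lemma dih_psi_1_2:
  assumes "n \<ge> 1"
  shows "dih_psi n 1 (dih_rot n k) = 1" "dih_psi n 1 (dih_refl n k) = 1"
    "dih_psi n 2 (dih_rot n k) = 1" "dih_psi n 2 (dih_refl n k) = - 1"
  using assms by (simp_all add: dih_psi_def dih_fun_rot_refl)

lemma dih_psi_3_4:
  assumes "n \<ge> 1" "even n"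
  shows "dih_psi n 3 (dih_rot n k) = (- 1) ^ k" "dih_psi n 3 (dih_refl n k) = (- 1) ^ k"
    "dih_psi n 4 (dih_rot n k) = (- 1) ^ k" "dih_psi n 4 (dih_refl n k) = (- 1) ^ (k + 1)"
proof -
  have "even (k mod n) \<longleftrightarrow> even k" for k
    using assms(2) by (simp add: dvd_mod_iff)
  then have "(- 1 :: complex) ^ (k mod n) = (- 1) ^ k" for k
    by (simp add: minus_one_power_iff)
  then show "dih_psi n 3 (dih_rot n k) = (- 1) ^ k" "dih_psi n 3 (dih_refl n k) = (- 1) ^ k"
    "dih_psi n 4 (dih_rot n k) = (- 1) ^ k" "dih_psi n 4 (dih_refl n k) = (- 1) ^ (k + 1)"
    using assms(1) by (simp_all add: dih_psi_def dih_fun_rot_refl)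
qed

lemma dih_chi_rot_refl:
  assumes "n \<ge> 1"
  shows "dih_chi n h (dih_rot n k) = complex_of_real (2 * cos (2 * real k * real h * pi / real n))"
    and "dih_chi n h (dih_refl n k) = 0"
proof -
  have "cos (2 * real (k mod n) * real h * pi / real n) = cos (2 * real k * real h * pi / real n)" for k
  proof -
    have "real k = real n * real (k div n) + real (k mod n)"
      by (metis mult_div_mod_eq of_nat_add of_nat_mult)
    then have "2 * real k * real h * pi / real n
        = 2 * real (k mod n) * real h * pi / real n + 2 * real (k div n * h) * pi"
      using assms by (simp add: field_simps)
    then show ?thesis
      by (simp only: cos_add cos_2npi sin_2npi)
  qed
  then show "dih_chi n h (dih_rot n k) = complex_of_real (2 * cos (2 * real k * real h * pi / real n))"
    and "dih_chi n h (dih_refl n k) = 0"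
    using assms by (simp_all add: dih_chi_def dih_fun_rot_refl)
qed


section \<open>Cayley graphs and spectra\<close>

definition cayley_graph :: "('a, 'm) monoid_scheme \<Rightarrow> 'a set \<Rightarrow> 'a pair_pre_digraph" where
  "cayley_graph G S =
    \<lparr>pverts = carrier G,
     parcs = {(x, y). x \<in> carrier G \<and> y \<in> carrier G \<and> inv\<^bsub>G\<^esub> x \<otimes>\<^bsub>G\<^esub> y \<in> S}\<rparr>"

lemma pair_graph_cayley_graph:
  assumes "group G" "finite (carrier G)"
    and S: "S \<subseteq> carrier G - {\<one>\<^bsub>G\<^esub>}" "set_inv\<^bsub>G\<^esub> S = S"
  shows "pair_graph (cayley_graph G S)"
proof -
  interpret group G by fact
  let ?X = "cayley_graph G S"
  have "sym (parcs ?X)"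
  proof (rule symI)
    fix x y assume "(x, y) \<in> parcs ?X"
    then have xy: "x \<in> carrier G" "y \<in> carrier G" "inv\<^bsub>G\<^esub> x \<otimes>\<^bsub>G\<^esub> y \<in> S"
      by (auto simp: cayley_graph_def)
    have "inv\<^bsub>G\<^esub> (inv\<^bsub>G\<^esub> x \<otimes>\<^bsub>G\<^esub> y) \<in> S"
      using xy(3) S(2) by (auto simp: SET_INV_def)
    with xy show "(y, x) \<in> parcs ?X"
      by (simp add: cayley_graph_def inv_mult_group)
  qed
  moreover have "finite (parcs ?X)"
    by (rule finite_subset[of _ "carrier G \<times> carrier G"]) (auto simp: cayley_graph_def assms(2))
  moreover have "fst e \<noteq> snd e" if "e \<in> parcs ?X" for e
    using that S(1) by (auto simp: cayley_graph_def)
  ultimately show ?thesis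
    using assms(2) by unfold_locales (auto simp: cayley_graph_def symmetric_def)
qed

definition adjacency_matrix :: "'a list \<Rightarrow> 'a pair_pre_digraph \<Rightarrow> complex mat" where
  "adjacency_matrix vs X =
    mat (length vs) (length vs) (\<lambda>(i, j). if (vs ! i, vs ! j) \<in> parcs X then 1 else 0)"

text \<open>Multiplicities are algebraic, i.e. as roots of the characteristic polynomial over the complex
  numbers. The order in which the vertices are listed is irrelevant (lemma \<open>graph_spectrum_eq\<close>).\<close>

definition graph_spectrum :: "'a pair_pre_digraph \<Rightarrow> complex multiset" where
  "graph_spectrum X =
    proots (char_poly (adjacency_matrix (SOME vs. distinct vs \<and> set vs = pverts X) X))"

lemma char_poly_adjacency_matrix_cong:
  assumes "distinct vs" "distinct ws" "set vs = set ws"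
  shows "char_poly (adjacency_matrix vs X) = char_poly (adjacency_matrix ws X)"
proof (rule char_poly_similar, rule similar_matI)
  define n where "n = length vs"
  have len: "length ws = n" using distinct_card[OF assms(1)] distinct_card[OF assms(2)] assms(3) by (simp add: n_def)
  define P where "P us us' = mat n n (\<lambda>(i, j). if us ! i = (us' ! j :: 'a) then 1 else (0 :: complex))"
    for us us'
  have pick: "(\<Sum>k = 0..<n. (if us ! k = x then (f (us ! k) :: complex) else 0)) = f x"
    if "distinct us" "length us = n" "x \<in> set us" for us f and x :: 'a
  proof -
    have bij: "bij_betw (\<lambda>k. us ! k) {0..<n} (set us)"
      by (rule bij_betw_nth) (use that in auto)
    have "(\<Sum>k = 0..<n. (if us ! k = x then (f (us ! k) :: complex) else 0))
        = (\<Sum>y\<in>set us. (if y = x then f y else 0))"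
      by (rule sum.reindex_bij_betw[OF bij, of "\<lambda>y. if y = x then f y else 0"])
    also have "\<dots> = f x"
      using that(3) by (simp only: sum.delta[OF finite_set] if_True)
    finally show ?thesis .
  qed
  have PP: "P us us' * P us' us = 1\<^sub>m n"
    if "distinct us" "distinct us'" "length us = n" "length us' = n" "set us = set us'" for us us'
  proof (rule eq_matI)
    fix i j assume "i < dim_row (1\<^sub>m n)" "j < dim_col (1\<^sub>m n)"
    then have ij: "i < n" "j < n" by auto
    have "(P us us' * P us' us) $$ (i, j)
        = (\<Sum>k = 0..<n. if us' ! k = us ! i then (if us' ! k = us ! j then 1 else 0) else 0)"
      using ij by (auto simp: P_def scalar_prod_def intro!: sum.cong)
    also have "\<dots> = (if us ! i = us ! j then 1 else 0)"
    proof (rule pick[of us' "us ! i" "\<lambda>x. if x = us ! j then 1 else 0"])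
      show "us ! i \<in> set us'" unfolding that(5)[symmetric] by (rule nth_mem) (simp add: that ij)
    qed (rule that)+
    finally show "(P us us' * P us' us) $$ (i, j) = 1\<^sub>m n $$ (i, j)"
      using ij that by (simp add: nth_eq_iff_index_eq)
  qed (auto simp: P_def)
  show "{adjacency_matrix vs X, adjacency_matrix ws X, P vs ws, P ws vs} \<subseteq> carrier_mat n n"
    by (auto simp: adjacency_matrix_def P_def n_def[symmetric] len)
  show "P vs ws * P ws vs = 1\<^sub>m n" "P ws vs * P vs ws = 1\<^sub>m n"
    by (rule PP; simp add: assms len n_def[symmetric])+
  let ?E = "\<lambda>x y. if (x, y) \<in> parcs X then 1 else (0 :: complex)"
  have 1: "P vs ws * adjacency_matrix ws X = mat n n (\<lambda>(i, j). ?E (vs ! i) (ws ! j))"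
  proof (rule eq_matI)
    fix i j assume "i < dim_row (mat n n (\<lambda>(i, j). ?E (vs ! i) (ws ! j)))"
      "j < dim_col (mat n n (\<lambda>(i, j). ?E (vs ! i) (ws ! j)))"
    then have ij: "i < n" "j < n" by auto
    have "(P vs ws * adjacency_matrix ws X) $$ (i, j)
        = (\<Sum>k = 0..<n. if ws ! k = vs ! i then ?E (ws ! k) (ws ! j) else 0)"
      using ij by (auto simp: P_def adjacency_matrix_def scalar_prod_def len intro!: sum.cong)
    also have "\<dots> = ?E (vs ! i) (ws ! j)"
      by (rule pick[of ws "vs ! i" "\<lambda>x. ?E x (ws ! j)"])
        (simp_all add: assms(2) assms(3)[symmetric] len ij n_def[symmetric])
    finally show "(P vs ws * adjacency_matrix ws X) $$ (i, j)
        = mat n n (\<lambda>(i, j). ?E (vs ! i) (ws ! j)) $$ (i, j)"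
      using ij by simp
  qed (auto simp: P_def adjacency_matrix_def len)
  show "adjacency_matrix vs X = P vs ws * adjacency_matrix ws X * P ws vs"
    unfolding 1
  proof (rule eq_matI)
    fix i j assume "i < dim_row (mat n n (\<lambda>(i, j). ?E (vs ! i) (ws ! j)) * P ws vs)"
      "j < dim_col (mat n n (\<lambda>(i, j). ?E (vs ! i) (ws ! j)) * P ws vs)"
    then have ij: "i < n" "j < n" by (auto simp: P_def)
    have "(mat n n (\<lambda>(i, j). ?E (vs ! i) (ws ! j)) * P ws vs) $$ (i, j)
        = (\<Sum>k = 0..<n. if ws ! k = vs ! j then ?E (vs ! i) (ws ! k) else 0)"
      using ij by (auto simp: P_def scalar_prod_def intro!: sum.cong)
    also have "\<dots> = ?E (vs ! i) (vs ! j)"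
      by (rule pick[of ws "vs ! j" "\<lambda>x. ?E (vs ! i) x"])
        (simp_all add: assms(2) assms(3)[symmetric] len ij n_def[symmetric])
    finally show "adjacency_matrix vs X $$ (i, j)
        = (mat n n (\<lambda>(i, j). ?E (vs ! i) (ws ! j)) * P ws vs) $$ (i, j)"
      using ij by (simp add: adjacency_matrix_def n_def)
  qed (auto simp: P_def adjacency_matrix_def n_def)
qed

lemma graph_spectrum_eq:
  assumes "distinct vs" "set vs = pverts X"
  shows "graph_spectrum X = proots (char_poly (adjacency_matrix vs X))"
proof -
  define ws where "ws = (SOME vs. distinct vs \<and> set vs = pverts X)"
  have ws: "distinct ws \<and> set ws = pverts X"
    unfolding ws_def by (rule someI[of _ vs]) (use assms in simp)
  have "char_poly (adjacency_matrix ws X) = char_poly (adjacency_matrix vs X)"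
    by (rule char_poly_adjacency_matrix_cong) (use ws assms in simp_all)
  then show ?thesis
    unfolding graph_spectrum_def ws_def by (rule arg_cong)
qed

end

theory Submission
  imports Defs
begin

text \<open>
  List the vertices as \<open>a\<^sup>k\<close> for \<open>0 \<le> k < n\<close>, followed by \<open>b a\<^sup>-\<^sup>k\<close> for \<open>0 \<le> k < n\<close>. The adjacency
  matrix then consists of four circulant blocks, which the Fourier matrix diagonalises
  simultaneously. With \<open>\<alpha>\<close> and \<open>\<beta>\<close> the Fourier transforms of the indicators of \<open>{k. a\<^sup>k \<in> S}\<close> and
  \<open>{k. b a\<^sup>k \<in> S}\<close>, the characteristic polynomial becomes the product over \<open>h < n\<close> of
  \<open>(x - \<alpha> h)\<^sup>2 - \<beta> (- h) \<beta> h\<close>. Since \<open>\<alpha>\<close> is even, \<open>h\<close> and \<open>n - h\<close> contribute the same factor, which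
  gives the double roots \<open>\<alpha> h \<plusminus> r\<close> with \<open>r\<^sup>2 = \<beta> (- h) \<beta> h\<close>. The factors with \<open>h = - h\<close> modulo \<open>n\<close>,
  that is \<open>h = 0\<close> and, for even \<open>n\<close>, \<open>h = n div 2\<close>, have the roots \<open>\<alpha> h \<plusminus> \<beta> h\<close>, which are the sums
  of the linear characters.
\<close>

section \<open>Roots of unity and the discrete Fourier transform\<close>

text \<open>Exponents are integers because index differences and negated indices occur
  throughout.\<close>

definition unity_root :: "nat \<Rightarrow> int \<Rightarrow> complex" where
  "unity_root n k = cis (2 * pi * of_int k / of_nat n)"

text \<open>The unnormalised transform on Z/n, with positive sign in the exponent. The function
  \<open>f\<close> stands for an \<open>n\<close>-periodic one and is sampled over one
  period.\<close>

definition fourier :: "nat \<Rightarrow> (int \<Rightarrow> complex) \<Rightarrow> int \<Rightarrow> complex" where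
  "fourier n f h = (\<Sum>k<n. f (int k) * unity_root n (h * int k))"

lemma unity_root_0 [simp]: "unity_root n 0 = 1"
  by (simp add: unity_root_def)

lemma unity_root_add: "unity_root n (j + k) = unity_root n j * unity_root n k"
  by (simp add: unity_root_def cis_mult add_divide_distrib distrib_left)

lemma unity_root_power: "unity_root n k ^ m = unity_root n (k * int m)"
  by (induction m) (simp_all add: unity_root_add distrib_left)

lemma unity_root_period: "n \<ge> 1 \<Longrightarrow> unity_root n (int n * k) = 1"
  using cis_multiple_2pi[of "of_int k"] by (simp add: unity_root_def mult.assoc)

lemma unity_root_mod:
  assumes "n \<ge> 1"
  shows "unity_root n (k mod int n) = unity_root n k"
proof -
  have "unity_root n k = unity_root n (int n * (k div int n) + k mod int n)"
    by simp
  also have "\<dots> = unity_root n (k mod int n)"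
    using assms by (simp only: unity_root_add unity_root_period mult_1)
  finally show ?thesis by simp
qed

lemma unity_root_mult_mod:
  "n \<ge> 1 \<Longrightarrow> unity_root n (h * (k mod int n)) = unity_root n (h * k)"
  by (metis unity_root_mod mod_mult_right_eq)

lemma unity_root_neq:
  assumes "j < n" "k < n" "j \<noteq> k"
  shows "unity_root n (int j - int k) \<noteq> 1"
proof
  assume "unity_root n (int j - int k) = 1"
  then have "unity_root n (int j) = unity_root n (int k)"
    using unity_root_add[of n "int j - int k" "int k"] by simp
  moreover have "inj_on (\<lambda>k. cis (2 * pi * real k / real n)) {..<n}"
    using bij_betw_roots_unity[of n] assms by (auto simp: bij_betw_def)
  ultimately show False
    using assms by (auto simp: unity_root_def inj_on_def)
qed

text \<open>Orthogonality of the characters of Z/n: off the diagonal this is a full geometric series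
  whose ratio is an \<open>n\<close>-th root of unity other than 1.\<close>

lemma sum_unity_root:
  assumes "j < n" "l < n"
  shows "(\<Sum>h<n. unity_root n (int h * (int j - int l))) = (if j = l then of_nat n else 0)"
proof (cases "j = l")
  case False
  let ?w = "unity_root n (int j - int l)"
  have "?w ^ n = 1"
    using assms unity_root_period[of n "int j - int l"] by (simp add: unity_root_power mult.commute)
  then have "(\<Sum>h<n. ?w ^ h) = 0"
    using unity_root_neq[OF assms False] by (simp add: geometric_sum)
  then show ?thesis
    using False by (simp add: unity_root_power mult.commute)
qed simp

text \<open>As \<open>c\<close> is its own inverse, sending \<open>k\<close> to
  \<open>c * k + j\<close> permutes the residues modulo \<open>n\<close>. The case
  \<open>c = 1\<close> serves for translations, \<open>c = - 1\<close> for reflections.\<close>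

lemma sum_periodic_reindex:
  fixes g :: "int \<Rightarrow> 'a :: comm_monoid_add"
  assumes "n \<ge> 1" and g: "\<And>i. g (i mod int n) = g i" and "c * c = 1"
  shows "(\<Sum>k<n. g (c * int k + j)) = (\<Sum>k<n. g (int k))"
proof -
  define p where "p k = nat ((c * int k + j) mod int n)" for k
  have p: "int (p k) = (c * int k + j) mod int n" for k
    using assms(1) by (simp add: p_def)
  have inj: "inj_on p {..<n}"
  proof (rule inj_onI)
    fix k l assume "k \<in> {..<n}" "l \<in> {..<n}" and eq: "p k = p l"
    have "(c * int k + j) mod int n = (c * int l + j) mod int n"
      using p[of k] p[of l] eq by simp
    \<comment> \<open>The extra factor \<open>c\<close> cancels the inner one, since
      \<open>c * c = 1\<close>.\<close>
    then have "int n dvd c * (c * int k - c * int l)"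
      by (simp add: mod_eq_dvd_iff)
    moreover have "c * (c * int k - c * int l) = int k - int l"
      using assms(3) by (simp add: right_diff_distrib mult.assoc[symmetric])
    ultimately have "int k mod int n = int l mod int n"
      by (simp add: mod_eq_dvd_iff)
    with \<open>k \<in> {..<n}\<close> \<open>l \<in> {..<n}\<close> show "k = l" by simp
  qed
  have "p ` {..<n} \<subseteq> {..<n}"
    using assms(1) by (auto simp: p_def nat_less_iff)
  then have "bij_betw p {..<n} {..<n}"
    using inj endo_inj_surj[of "{..<n}" p] by (simp add: bij_betw_def)
  then have "(\<Sum>k<n. g (int k)) = (\<Sum>k<n. g (int (p k)))"
    by (rule sum.reindex_bij_betw[symmetric])
  then show ?thesis by (simp add: p g)
qed

text \<open>Translation turns into multiplication by a phase. Read along row \<open>j\<close> of a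
  circulant matrix, this is the eigenvector equation for the \<open>h\<close>-th Fourier
  vector.\<close>

lemma fourier_shift:
  assumes "n \<ge> 1" and "\<And>i. f (i mod int n) = f i"
  shows "(\<Sum>k<n. f (int k - int j) * unity_root n (int h * int k))
    = unity_root n (int h * int j) * fourier n f (int h)"
proof -
  let ?g = "\<lambda>i. f (i - int j) * unity_root n (int h * i)"
  have *: "f (i mod int n - int j) = f (i - int j)" for i
    by (metis assms(2) mod_diff_left_eq)
  have "(\<Sum>k<n. ?g (int k)) = (\<Sum>k<n. ?g (1 * int k + int j))"
    by (rule sum_periodic_reindex[symmetric])
       (use assms in \<open>simp_all add: * unity_root_mult_mod\<close>)
  also have "\<dots> = unity_root n (int h * int j) * fourier n f (int h)"
    by (simp add: fourier_def distrib_left unity_root_add sum_distrib_left mult_ac)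
  finally show ?thesis .
qed

lemma fourier_reflect:
  assumes "n \<ge> 1" and "\<And>i. f (i mod int n) = f i"
  shows "fourier n (\<lambda>i. f (- i)) h = fourier n f (- h)"
proof -
  define m where "m = - h"
  let ?g = "\<lambda>i. f i * unity_root n (m * i)"
  have "(\<Sum>k<n. ?g (- 1 * int k + 0)) = (\<Sum>k<n. ?g (int k))"
    by (rule sum_periodic_reindex) (use assms in \<open>simp_all add: unity_root_mult_mod\<close>)
  then show ?thesis by (simp add: fourier_def m_def)
qed

lemma fourier_period:
  assumes "n \<ge> 1"
  shows "fourier n f (h mod int n) = fourier n f h"
  by (metis (no_types, lifting) assms fourier_def mult.commute sum.cong unity_root_mult_mod)

text \<open>On the nonzero residues, \<open>h\<close> and \<open>n - h\<close> are paired; only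
  \<open>n div 2\<close> with \<open>n\<close> even is its own partner. Values in a commutative
  monoid allow \<open>M\<close> to be a multiset.\<close>

lemma sum_symmetric_residues:
  fixes M :: "nat \<Rightarrow> 'a :: comm_monoid_add"
  assumes "n \<ge> 1" and "\<And>h. \<lbrakk>1 \<le> h; h < n\<rbrakk> \<Longrightarrow> M (n - h) = M h"
  shows "(\<Sum>h<n. M h) =
    M 0 + (if even n then M (n div 2) else 0) + (\<Sum>h = 1..(n - 1) div 2. M h + M h)"
proof -
  define m where "m = (n - 1) div 2"
  let ?C = "if even n then {n div 2} else {}"
  have split: "{..<n} = insert 0 (?C \<union> ({1..m} \<union> {n - m..<n}))"
    using assms(1) by (cases "even n") (auto simp: m_def elim!: evenE oddE)
  have "(\<Sum>h = n - m..<n. M h) = (\<Sum>h = 1..m. M h)"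
    by (rule sum.reindex_bij_witness[of _ "\<lambda>h. n - h" "\<lambda>h. n - h"])
       (use assms in \<open>auto simp: m_def\<close>)
  moreover have "{1..m} \<inter> {n - m..<n} = {}" "?C \<inter> ({1..m} \<union> {n - m..<n}) = {}"
    "0 \<notin> ?C \<union> ({1..m} \<union> {n - m..<n})"
    using assms(1) by (auto simp: m_def elim!: evenE)
  ultimately show ?thesis
    unfolding split m_def[symmetric] by (simp add: sum.union_disjoint sum.distrib add_ac)
qed

section \<open>Circulant matrices\<close>

text \<open>A difference of squares, hence a product of two linear factors. Nonvanishing is needed
  to collect the roots of a product factor by factor.\<close>

lemma proots_sq_minus:
  fixes a r :: complex
  shows "proots ([:- a, 1:] * [:- a, 1:] - [:r * r:]) = {#a + r, a - r#}"
    and "[:- a, 1:] * [:- a, 1:] - [:r * r:] \<noteq> 0"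
proof -
  have eq: "[:- a, 1:] * [:- a, 1:] - [:r * r:] = [:- (a + r), 1:] * [:- (a - r), 1:]"
    by (simp add: algebra_simps)
  show "proots ([:- a, 1:] * [:- a, 1:] - [:r * r:]) = {#a + r, a - r#}"
    unfolding eq by (subst proots_mult) simp_all
  show "[:- a, 1:] * [:- a, 1:] - [:r * r:] \<noteq> 0"
    unfolding eq by (rule no_zero_divisors) simp_all
qed

lemma det_mat_diag: "det (mat_diag n f) = (\<Prod>i<n. f i)"
proof -
  have "det (mat_diag n f) = prod_list (diag_mat (mat_diag n f))"
    by (rule det_upper_triangular[of _ n]) (auto simp: mat_diag_def)
  then show ?thesis
    by (simp add: prod_list_diag_prod mat_diag_def atLeast0LessThan)
qed

text \<open>Diagonal blocks commute, so the block determinant equals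
  \<open>det (A * D - B * C)\<close>, and this difference is again diagonal.\<close>

lemma char_poly_four_block_diag:
  fixes f :: "nat \<Rightarrow> 'a :: idom"
  shows "char_poly (four_block_mat (mat_diag n f) (mat_diag n g) (mat_diag n g') (mat_diag n f))
    = (\<Prod>i<n. [:- f i, 1:] * [:- f i, 1:] - [:g i * g' i:])"
proof -
  have 1: "char_poly_matrix
      (four_block_mat (mat_diag n f) (mat_diag n g) (mat_diag n g') (mat_diag n f))
    = four_block_mat (mat_diag n (\<lambda>i. [:- f i, 1:])) (mat_diag n (\<lambda>i. [:- g i:]))
        (mat_diag n (\<lambda>i. [:- g' i:])) (mat_diag n (\<lambda>i. [:- f i, 1:]))"
    by (rule eq_matI) (auto simp: char_poly_matrix_def mat_diag_def)
  have 2: "mat_diag n (\<lambda>i. [:- f i, 1:] * [:- f i, 1:]) - mat_diag n (\<lambda>i. [:- g i:] * [:- g' i:])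
    = mat_diag n (\<lambda>i. [:- f i, 1:] * [:- f i, 1:] - [:g i * g' i:])"
    by (rule eq_matI) (auto simp: mat_diag_def)
  show ?thesis
    unfolding char_poly_def 1
    by (subst det_four_block_mat[of _ n])
       (simp_all only: mat_diag_dim mat_diag_diag 2 det_mat_diag mult.commute)
qed

text \<open>The index \<open>k - j\<close> matches the adjacency condition, which multiplies the
  inverse of the row vertex by the column vertex.\<close>

definition circulant :: "nat \<Rightarrow> (int \<Rightarrow> complex) \<Rightarrow> complex mat" where
  "circulant n f = mat n n (\<lambda>(j, k). f (int k - int j))"

definition fourier_mat :: "nat \<Rightarrow> complex mat" where
  "fourier_mat n = mat n n (\<lambda>(j, k). unity_root n (int j * int k))"

definition fourier_mat_inv :: "nat \<Rightarrow> complex mat" where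
  "fourier_mat_inv n = mat n n (\<lambda>(j, k). unity_root n (- (int j * int k)) / of_nat n)"

lemma circulant_carrier [simp]: "circulant n f \<in> carrier_mat n n"
  and fourier_mat_carrier [simp]: "fourier_mat n \<in> carrier_mat n n"
  and fourier_mat_inv_carrier [simp]: "fourier_mat_inv n \<in> carrier_mat n n"
  by (simp_all add: circulant_def fourier_mat_def fourier_mat_inv_def)

text \<open>The first product is the orthogonality of characters; for square matrices a right
  inverse is also a left inverse.\<close>

lemma fourier_mat_inverse:
  "fourier_mat n * fourier_mat_inv n = 1\<^sub>m n" "fourier_mat_inv n * fourier_mat n = 1\<^sub>m n"
proof -
  show 1: "fourier_mat n * fourier_mat_inv n = 1\<^sub>m n"
  proof (rule eq_matI)
    fix j l assume "j < dim_row (1\<^sub>m n)" "l < dim_col (1\<^sub>m n)"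
    then have jl: "j < n" "l < n" by auto
    have "(fourier_mat n * fourier_mat_inv n) $$ (j, l)
        = (\<Sum>k<n. unity_root n (int k * (int j - int l))) / of_nat n"
      using jl unfolding sum_divide_distrib
      by (auto simp: fourier_mat_def fourier_mat_inv_def scalar_prod_def atLeast0LessThan
          unity_root_add[symmetric] algebra_simps intro!: sum.cong)
    then show "(fourier_mat n * fourier_mat_inv n) $$ (j, l) = 1\<^sub>m n $$ (j, l)"
      using jl by (simp add: sum_unity_root)
  qed (simp_all add: fourier_mat_def fourier_mat_inv_def)
  show "fourier_mat_inv n * fourier_mat n = 1\<^sub>m n"
    by (rule mat_mult_left_right_inverse[OF _ _ 1]) simp_all
qed

text \<open>The columns of the Fourier matrix are eigenvectors of every circulant matrix; only the
  eigenvalues depend on \<open>f\<close>.\<close>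

lemma circulant_fourier_mat:
  assumes "n \<ge> 1" and "\<And>i. f (i mod int n) = f i"
  shows "circulant n f * fourier_mat n = fourier_mat n * mat_diag n (\<lambda>h. fourier n f (int h))"
  unfolding mat_diag_mult_right[OF fourier_mat_carrier]
proof (rule eq_matI)
  fix j h assume "j < dim_row (mat n n (\<lambda>(i, j). fourier_mat n $$ (i, j) * fourier n f (int j)))"
    "h < dim_col (mat n n (\<lambda>(i, j). fourier_mat n $$ (i, j) * fourier n f (int j)))"
  then have jh: "j < n" "h < n" by auto
  have "(circulant n f * fourier_mat n) $$ (j, h)
      = (\<Sum>k<n. f (int k - int j) * unity_root n (int h * int k))"
    using jh by (auto simp: circulant_def fourier_mat_def scalar_prod_def atLeast0LessThan
        mult.commute[of "int h"] intro!: sum.cong)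
  then show "(circulant n f * fourier_mat n) $$ (j, h)
      = mat n n (\<lambda>(i, j). fourier_mat n $$ (i, j) * fourier n f (int j)) $$ (j, h)"
    using jh fourier_shift[where f = f, OF assms] by (simp add: fourier_mat_def mult.commute[of "int j"])
qed (simp_all add: circulant_def fourier_mat_def)

text \<open>Conjugation by two diagonal copies of the Fourier matrix makes all four blocks diagonal.
  The reflected block contributes the transform of \<open>g\<close> at \<open>- h\<close>.\<close>

lemma char_poly_four_block_circulant:
  assumes "n \<ge> 1" and f: "\<And>i. f (i mod int n) = f i" and g: "\<And>i. g (i mod int n) = g i"
  shows "char_poly (four_block_mat (circulant n f) (circulant n (\<lambda>i. g (- i)))
      (circulant n g) (circulant n f))
    = (\<Prod>h<n. [:- fourier n f (int h), 1:] * [:- fourier n f (int h), 1:]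
        - [:fourier n g (- int h) * fourier n g (int h):])"
proof -
  define g' where "g' i = g (- i)" for i
  have g': "g' (i mod int n) = g' i" for i
    unfolding g'_def by (metis g mod_minus_eq)
  have fg': "fourier n g' h = fourier n g (- h)" for h
    unfolding g'_def by (rule fourier_reflect) fact+
  let ?F = "fourier_mat n" and ?I = "fourier_mat_inv n" and ?Z = "0\<^sub>m n n"
  let ?D = "\<lambda>f. mat_diag n (\<lambda>h. fourier n f (int h))"
  define A where "A = four_block_mat (circulant n f) (circulant n g') (circulant n g) (circulant n f)"
  define B where "B = four_block_mat (?D f) (?D g') (?D g) (?D f)"
  define P where "P = four_block_mat ?F ?Z ?Z ?F"
  define Q where "Q = four_block_mat ?I ?Z ?Z ?I"
  have carrier: "A \<in> carrier_mat (n + n) (n + n)" "B \<in> carrier_mat (n + n) (n + n)"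
    "P \<in> carrier_mat (n + n) (n + n)" "Q \<in> carrier_mat (n + n) (n + n)"
    by (simp_all add: A_def B_def P_def Q_def)
  note circ = circulant_fourier_mat[where f = f, OF assms(1) f]
    circulant_fourier_mat[where f = g, OF assms(1) g]
    circulant_fourier_mat[where f = g', OF assms(1) g']
  note block = mult_four_block_mat[where ?nr1.0 = n and ?n1.0 = n and ?n2.0 = n
      and ?nr2.0 = n and ?nc1.0 = n and ?nc2.0 = n]
  have PQ: "P * Q = 1\<^sub>m (n + n)" "Q * P = 1\<^sub>m (n + n)"
    by (simp_all add: P_def Q_def block fourier_mat_inverse right_mult_zero_mat[of _ n n]
        left_mult_zero_mat[of _ n n])
  have "?F * mat_diag n d \<in> carrier_mat n n" for d
    by (rule mult_carrier_mat[of _ n n]) simp_all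
  \<comment> \<open>Block by block this is the eigenvector equation for \<open>f\<close>,
    \<open>g'\<close> and \<open>g\<close>.\<close>
  then have "A * P = P * B"
    by (simp add: A_def B_def P_def block
        right_mult_zero_mat[of _ n n] left_mult_zero_mat[of _ n n]
        left_add_zero_mat[of _ n n] right_add_zero_mat[of _ n n] circ)
  then have "P * B * Q = A * (P * Q)"
    using assoc_mult_mat[OF carrier(1,3,4)] by simp
  then have "A = P * B * Q" using carrier(1) by (simp add: PQ)
  then have "similar_mat A B"
    using carrier PQ by (intro similar_matI[where P = P and Q = Q and n = "n + n"]) auto
  then show ?thesis
    by (simp add: char_poly_similar A_def B_def char_poly_four_block_diag fg' flip: g'_def)
qed

section \<open>Rotations and reflections with integer exponents\<close>

text \<open>Integer exponents make index arithmetic match that of \<open>unity_root\<close> and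
  avoid truncated subtraction.\<close>

definition rotation :: "nat \<Rightarrow> int \<Rightarrow> dihedral_gen word set" where
  "rotation n i = dih_a n [^]\<^bsub>dihedral_group n\<^esub> i"

definition reflection :: "nat \<Rightarrow> int \<Rightarrow> dihedral_gen word set" where
  "reflection n i = dih_b n \<otimes>\<^bsub>dihedral_group n\<^esub> rotation n i"

lemma dih_rot_eq_rotation: "dih_rot n k = rotation n (int k)"
  and dih_refl_eq_reflection: "dih_refl n k = reflection n (int k)"
  by (simp_all add: dih_rot_def dih_refl_def rotation_def reflection_def int_pow_int)

lemma rotation_closed [simp]: "rotation n i \<in> carrier (dihedral_group n)"
  and reflection_closed [simp]: "reflection n i \<in> carrier (dihedral_group n)"
proof -
  interpret group "dihedral_group n" by (rule group_dihedral_group)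
  show "rotation n i \<in> carrier (dihedral_group n)" "reflection n i \<in> carrier (dihedral_group n)"
    by (simp_all add: rotation_def reflection_def dih_a_closed dih_b_closed)
qed

lemma rotation_add: "rotation n i \<otimes>\<^bsub>dihedral_group n\<^esub> rotation n j = rotation n (i + j)"
  and inv_rotation: "inv\<^bsub>dihedral_group n\<^esub> rotation n i = rotation n (- i)"
proof -
  interpret group "dihedral_group n" by (rule group_dihedral_group)
  show "rotation n i \<otimes>\<^bsub>dihedral_group n\<^esub> rotation n j = rotation n (i + j)"
    "inv\<^bsub>dihedral_group n\<^esub> rotation n i = rotation n (- i)"
    by (simp_all add: rotation_def dih_a_closed int_pow_mult int_pow_neg)
qed

lemma rotation_mod: "rotation n (i mod int n) = rotation n i"
proof -
  interpret group "dihedral_group n" by (rule group_dihedral_group)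
  have "rotation n (int n * j) = \<one>\<^bsub>dihedral_group n\<^esub>" for j
    by (simp add: rotation_def int_pow_pow[symmetric] int_pow_int dih_a_closed dih_a_pow)
  then have "rotation n (int n * (i div int n) + i mod int n) = rotation n (i mod int n)"
    by (simp only: rotation_add[symmetric] l_one rotation_closed)
  then show ?thesis by simp
qed

lemma reflection_mod: "reflection n (i mod int n) = reflection n i"
  by (simp add: reflection_def rotation_mod)

lemma rotation_conj_b:
  assumes "n \<ge> 1"
  shows "dih_b n \<otimes>\<^bsub>dihedral_group n\<^esub> rotation n i \<otimes>\<^bsub>dihedral_group n\<^esub> dih_b n = rotation n (- i)"
proof -
  interpret group "dihedral_group n" by (rule group_dihedral_group)
  let ?D = "dihedral_group n" and ?b = "dih_b n"
  note cl = dih_b_closed[of n]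
  have nat: "?b \<otimes>\<^bsub>?D\<^esub> rotation n (int k) \<otimes>\<^bsub>?D\<^esub> ?b = rotation n (- int k)" for k
  proof (induction k)
    case 0
    then show ?case using cl by (simp add: rotation_def dih_b_square)
  next
    case (Suc k)
    have 1: "?b \<otimes>\<^bsub>?D\<^esub> rotation n 1 \<otimes>\<^bsub>?D\<^esub> ?b = rotation n (- 1)"
      using dih_bab[of n] by (simp add: rotation_def dih_a_closed int_pow_neg)
    \<comment> \<open>Inserting \<open>b * b = 1\<close> splits the conjugate of a product into a
      product of conjugates.\<close>
    have "rotation n (int (Suc k)) = rotation n (int k) \<otimes>\<^bsub>?D\<^esub> (?b \<otimes>\<^bsub>?D\<^esub> ?b) \<otimes>\<^bsub>?D\<^esub> rotation n 1"
      by (simp add: dih_b_square rotation_add add.commute)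
    then have "?b \<otimes>\<^bsub>?D\<^esub> rotation n (int (Suc k)) \<otimes>\<^bsub>?D\<^esub> ?b
        = (?b \<otimes>\<^bsub>?D\<^esub> rotation n (int k) \<otimes>\<^bsub>?D\<^esub> ?b) \<otimes>\<^bsub>?D\<^esub> (?b \<otimes>\<^bsub>?D\<^esub> rotation n 1 \<otimes>\<^bsub>?D\<^esub> ?b)"
      using cl by (simp add: m_assoc)
    also have "\<dots> = rotation n (- int (Suc k))"
      unfolding Suc 1 rotation_add by (rule arg_cong[of _ _ "rotation n"]) simp
    finally show ?case .
  qed
  \<comment> \<open>An arbitrary exponent is replaced by its residue, nonnegative since n \<ge> 1,
    to which the natural case applies.\<close>
  have "?b \<otimes>\<^bsub>?D\<^esub> rotation n (i mod int n) \<otimes>\<^bsub>?D\<^esub> ?b = rotation n (- (i mod int n))"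
    using nat[of "nat (i mod int n)"] assms by simp
  then show ?thesis
    by (metis rotation_mod mod_minus_eq)
qed

lemma dihedral_mult:
  assumes "n \<ge> 1"
  shows "rotation n i \<otimes>\<^bsub>dihedral_group n\<^esub> rotation n j = rotation n (i + j)"
    and "rotation n i \<otimes>\<^bsub>dihedral_group n\<^esub> reflection n j = reflection n (j - i)"
    and "reflection n i \<otimes>\<^bsub>dihedral_group n\<^esub> rotation n j = reflection n (i + j)"
    and "reflection n i \<otimes>\<^bsub>dihedral_group n\<^esub> reflection n j = rotation n (j - i)"
proof -
  interpret group "dihedral_group n" by (rule group_dihedral_group)
  let ?D = "dihedral_group n" and ?b = "dih_b n"
  note cl = dih_b_closed[of n]
  show "rotation n i \<otimes>\<^bsub>?D\<^esub> rotation n j = rotation n (i + j)"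
    by (rule rotation_add)
  show "reflection n i \<otimes>\<^bsub>?D\<^esub> rotation n j = reflection n (i + j)"
    using cl by (simp add: reflection_def m_assoc rotation_add)
  show 1: "reflection n i \<otimes>\<^bsub>?D\<^esub> reflection n j = rotation n (j - i)" for i j
  proof -
    have "reflection n i \<otimes>\<^bsub>?D\<^esub> reflection n j
        = (?b \<otimes>\<^bsub>?D\<^esub> rotation n i \<otimes>\<^bsub>?D\<^esub> ?b) \<otimes>\<^bsub>?D\<^esub> rotation n j"
      using cl by (simp add: reflection_def m_assoc)
    then show ?thesis using assms by (simp add: rotation_conj_b rotation_add)
  qed
  \<comment> \<open>A factor \<open>b * b = 1\<close> on the left reduces this mixed product to a
    product of two reflections.\<close>
  have "rotation n i \<otimes>\<^bsub>?D\<^esub> reflection n j = ?b \<otimes>\<^bsub>?D\<^esub> (?b \<otimes>\<^bsub>?D\<^esub> rotation n i) \<otimes>\<^bsub>?D\<^esub> reflection n j"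
    using cl by (simp add: m_assoc[symmetric] dih_b_square)
  also have "\<dots> = ?b \<otimes>\<^bsub>?D\<^esub> (reflection n i \<otimes>\<^bsub>?D\<^esub> reflection n j)"
    using cl by (simp add: m_assoc reflection_def)
  also have "\<dots> = reflection n (j - i)"
    unfolding 1 by (simp add: reflection_def)
  finally show "rotation n i \<otimes>\<^bsub>?D\<^esub> reflection n j = reflection n (j - i)" .
qed

lemma inv_reflection:
  assumes "n \<ge> 1"
  shows "inv\<^bsub>dihedral_group n\<^esub> reflection n i = reflection n i"
proof -
  interpret group "dihedral_group n" by (rule group_dihedral_group)
  show ?thesis
    by (rule inv_equality) (use assms in \<open>simp_all add: dihedral_mult, simp add: rotation_def\<close>)
qed

lemma rotation_eq_dih_rot: "n \<ge> 1 \<Longrightarrow> rotation n i = dih_rot n (nat (i mod int n))"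
  and reflection_eq_dih_refl: "n \<ge> 1 \<Longrightarrow> reflection n i = dih_refl n (nat (i mod int n))"
  by (simp_all add: dih_rot_eq_rotation dih_refl_eq_reflection rotation_mod reflection_mod)

section \<open>Indicators of \<open>S\<close> on exponents, and the order of the vertices\<close>

definition rotation_ind :: "nat \<Rightarrow> dihedral_gen word set set \<Rightarrow> int \<Rightarrow> complex" where
  "rotation_ind n S i = of_bool (rotation n i \<in> S)"

definition reflection_ind :: "nat \<Rightarrow> dihedral_gen word set set \<Rightarrow> int \<Rightarrow> complex" where
  "reflection_ind n S i = of_bool (reflection n i \<in> S)"

lemma rotation_ind_mod: "rotation_ind n S (i mod int n) = rotation_ind n S i"
  and reflection_ind_mod: "reflection_ind n S (i mod int n) = reflection_ind n S i"
  by (simp_all add: rotation_ind_def reflection_ind_def rotation_mod reflection_mod)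

text \<open>This makes the transform of \<open>rotation_ind\<close> even. Reflections are their own
  inverses, so closure under inversion gives no such symmetry for
  \<open>reflection_ind\<close>.\<close>

lemma rotation_ind_minus:
  assumes "S = set_inv\<^bsub>dihedral_group n\<^esub> S"
  shows "rotation_ind n S (- i) = rotation_ind n S i"
proof -
  have "rotation n (- i) \<in> S" if "rotation n i \<in> S" for i
    using that assms by (auto simp: SET_INV_def inv_rotation[symmetric])
  from this[of i] this[of "- i"] show ?thesis by (auto simp: rotation_ind_def)
qed

text \<open>Turns character sums over \<open>S\<close> into weighted sums over exponents, from which
  Fourier transforms can be read off.\<close>

lemma sum_dihedral_subset:
  fixes \<phi> :: "dihedral_gen word set \<Rightarrow> complex"
  assumes n: "n \<ge> 1" and S: "S \<subseteq> carrier (dihedral_group n)"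
  shows "(\<Sum>s\<in>S. \<phi> s) = (\<Sum>k<n. rotation_ind n S (int k) * \<phi> (rotation n (int k)))
    + (\<Sum>k<n. reflection_ind n S (int k) * \<phi> (reflection n (int k)))"
proof -
  have inj: "inj_on (dih_rot n) {..<n}" "inj_on (dih_refl n) {..<n}"
    using n by (auto simp: inj_on_def dih_rot_eq_iff dih_refl_eq_iff)
  have disj: "dih_rot n ` {..<n} \<inter> dih_refl n ` {..<n} = {}"
    using n by (auto simp: dih_rot_neq_refl)
  have "(\<Sum>s\<in>S. \<phi> s) = (\<Sum>s\<in>carrier (dihedral_group n). of_bool (s \<in> S) * \<phi> s)"
    using S finite_dihedral_group[OF n] by (intro sum.mono_neutral_cong_left) auto
  also have "\<dots> = (\<Sum>s\<in>dih_rot n ` {..<n}. of_bool (s \<in> S) * \<phi> s)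
      + (\<Sum>s\<in>dih_refl n ` {..<n}. of_bool (s \<in> S) * \<phi> s)"
    unfolding dihedral_group_carrier[OF n] using disj by (intro sum.union_disjoint) auto
  finally show ?thesis
    unfolding sum.reindex[OF inj(1)] sum.reindex[OF inj(2)]
    by (simp only: o_def rotation_ind_def reflection_ind_def
        dih_rot_eq_rotation dih_refl_eq_reflection)
qed

text \<open>
  The exponent \<open>- int k\<close> makes the off-diagonal blocks of the adjacency matrix circulant; with
  \<open>int k\<close> they would be Hankel matrices.
\<close>

definition dihedral_list :: "nat \<Rightarrow> dihedral_gen word set list" where
  "dihedral_list n = map (\<lambda>k. rotation n (int k)) [0..<n] @ map (\<lambda>k. reflection n (- int k)) [0..<n]"

lemma set_dihedral_list:
  assumes "n \<ge> 1"
  shows "set (dihedral_list n) = carrier (dihedral_group n)"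
proof
  show "set (dihedral_list n) \<subseteq> carrier (dihedral_group n)"
    by (auto simp: dihedral_list_def)
  \<comment> \<open>The list holds reflections with negated exponents; the one equal to
    \<open>dih_refl n k\<close> sits at the residue of \<open>- int k\<close>.\<close>
  have "dih_refl n k \<in> (\<lambda>k. reflection n (- int k)) ` {..<n}" if "k < n" for k
  proof (rule image_eqI)
    have "int (nat (- int k mod int n)) = - int k mod int n"
      using assms by simp
    then show "dih_refl n k = reflection n (- int (nat (- int k mod int n)))"
      using reflection_mod[of n "- (- int k mod int n)"] reflection_mod[of n "int k"]
      by (simp add: dih_refl_eq_reflection mod_minus_eq)
    show "nat (- int k mod int n) \<in> {..<n}"
      using assms by (simp add: nat_less_iff)
  qed
  then show "carrier (dihedral_group n) \<subseteq> set (dihedral_list n)"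
    by (auto simp: dihedral_list_def dihedral_group_carrier[OF assms] dih_rot_eq_rotation
        atLeast0LessThan)
qed

text \<open>By counting: the length equals the order of the group, and every element is
  listed.\<close>

lemma distinct_dihedral_list:
  assumes "n \<ge> 1"
  shows "distinct (dihedral_list n)"
proof (rule card_distinct)
  have "length (dihedral_list n) = 2 * n"
    by (simp add: dihedral_list_def)
  then show "card (set (dihedral_list n)) = length (dihedral_list n)"
    by (simp only: set_dihedral_list[OF assms] card_dihedral_group[OF assms])
qed

section \<open>The spectrum of a dihedral Cayley graph\<close>

text \<open>By the multiplication table, the exponent tested for membership in \<open>S\<close>
  depends in each block only on the difference of the two positions.\<close>

lemma adjacency_matrix_dihedral:
  assumes n: "n \<ge> 1" and S: "S = set_inv\<^bsub>dihedral_group n\<^esub> S"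
  shows "adjacency_matrix (dihedral_list n) (cayley_graph (dihedral_group n) S)
    = four_block_mat (circulant n (rotation_ind n S)) (circulant n (\<lambda>i. reflection_ind n S (- i)))
        (circulant n (reflection_ind n S)) (circulant n (rotation_ind n S))"
    (is "?A = ?B")
proof (rule eq_matI)
  have len: "length (dihedral_list n) = n + n"
    by (simp add: dihedral_list_def)
  fix i j assume "i < dim_row ?B" "j < dim_col ?B"
  then have ij: "i < n + n" "j < n + n" by (auto simp: circulant_def)
  have nth: "dihedral_list n ! k = rotation n (int k)"
    "dihedral_list n ! (n + k) = reflection n (- int k)" if "k < n" for k
    using that by (simp_all add: dihedral_list_def nth_append)
  \<comment> \<open>In the lower right block the product is the rotation by \<open>i - j\<close>,
    whereas \<open>circulant\<close> expects \<open>j - i\<close>; closure under inversion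
    reconciles them.\<close>
  have sym: "rotation n (i - j) \<in> S \<longleftrightarrow> rotation n (j - i) \<in> S" for i j
    using rotation_ind_minus[OF S, of "j - i"] by (auto simp: rotation_ind_def of_bool_def split: if_splits)
  have half: "k < n \<or> (\<exists>k'<n. k = n + k')" if "k < n + n" for k
    using that by presburger
  from half[OF ij(1)] half[OF ij(2)] show "?A $$ (i, j) = ?B $$ (i, j)"
    by (elim disjE exE conjE)
       (simp_all add: adjacency_matrix_def len nth cayley_graph_def circulant_def inv_rotation
          inv_reflection[OF n] dihedral_mult[OF n] rotation_ind_def reflection_ind_def of_bool_def
          sym[of "int _" "int _"])
qed (simp_all add: adjacency_matrix_def dihedral_list_def circulant_def)

text \<open>Any choice of square roots \<open>r\<close> will do, since a change of sign only swaps
  the two roots of a factor.\<close>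

lemma graph_spectrum_dihedral:
  assumes n: "n \<ge> 1" and S: "S = set_inv\<^bsub>dihedral_group n\<^esub> S"
  defines "\<alpha> \<equiv> fourier n (rotation_ind n S)" and "\<beta> \<equiv> fourier n (reflection_ind n S)"
  assumes r: "\<And>h. r h * r h = \<beta> (- int h) * \<beta> (int h)"
  shows "graph_spectrum (cayley_graph (dihedral_group n) S)
    = (\<Sum>h<n. {#\<alpha> (int h) + r h, \<alpha> (int h) - r h#})"
proof -
  have "graph_spectrum (cayley_graph (dihedral_group n) S)
      = proots (char_poly (adjacency_matrix (dihedral_list n) (cayley_graph (dihedral_group n) S)))"
    by (rule graph_spectrum_eq)
       (use n in \<open>simp_all add: distinct_dihedral_list set_dihedral_list cayley_graph_def\<close>)
  also have "\<dots> = proots (\<Prod>h<n. [:- \<alpha> (int h), 1:] * [:- \<alpha> (int h), 1:] - [:r h * r h:])"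
    unfolding adjacency_matrix_dihedral[OF n S] r \<alpha>_def \<beta>_def
    by (subst char_poly_four_block_circulant[where f = "rotation_ind n S" and g = "reflection_ind n S",
        OF n rotation_ind_mod reflection_ind_mod]) simp
  also have "\<dots> = (\<Sum>h<n. {#\<alpha> (int h) + r h, \<alpha> (int h) - r h#})"
    by (subst proots_prod) (simp_all only: proots_sq_minus, simp)
  finally show ?thesis .
qed

section \<open>Character sums as Fourier coefficients\<close>

lemma dih_chi_rotation:
  assumes "n \<ge> 1"
  shows "dih_chi n h (rotation n i) = unity_root n (int h * i) + unity_root n (- int h * i)"
proof -
  define k where "k = nat (i mod int n)"
  have k: "int k = i mod int n"
    using assms by (simp add: k_def)
  have "dih_chi n h (rotation n i) = complex_of_real (2 * cos (2 * real k * real h * pi / real n))"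
    unfolding rotation_eq_dih_rot[OF assms] k_def[symmetric] by (rule dih_chi_rot_refl(1)[OF assms])
  \<comment> \<open>Euler's formula: twice the cosine is the sum of two conjugate roots of
    unity.\<close>
  also have "\<dots> = unity_root n (int h * int k) + unity_root n (- int h * int k)"
    by (simp add: unity_root_def complex_eq_iff mult_ac)
  also have "\<dots> = unity_root n (int h * i) + unity_root n (- int h * i)"
    unfolding k using assms by (simp only: unity_root_mult_mod)
  finally show ?thesis .
qed

lemma dih_chi_reflection: "n \<ge> 1 \<Longrightarrow> dih_chi n h (reflection n i) = 0"
  by (simp add: reflection_eq_dih_refl dih_chi_rot_refl)

lemma sum_dih_chi:
  assumes "n \<ge> 1" and "S \<subseteq> carrier (dihedral_group n)"
  shows "(\<Sum>s\<in>S. dih_chi n h s)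
    = fourier n (rotation_ind n S) (int h) + fourier n (rotation_ind n S) (- int h)"
  using assms
  by (simp add: sum_dihedral_subset dih_chi_rotation dih_chi_reflection fourier_def distrib_left
      sum.distrib)

lemma fourier_mult:
  "fourier n f h * fourier n g h' =
    (\<Sum>j<n. \<Sum>k<n. f (int j) * g (int k) * unity_root n (h * int j + h' * int k))"
  unfolding fourier_def sum_product by (simp add: unity_root_add mult_ac)

text \<open>Only products of two rotations or of two reflections are rotations, and
  \<open>dih_chi\<close> vanishes elsewhere. Exponents add in the first case, giving squares of
  \<alpha>, and subtract in the second, giving the mixed products of \<beta>.\<close>

lemma sum_dih_chi_mult:
  assumes n: "n \<ge> 1" and S: "S \<subseteq> carrier (dihedral_group n)"
  defines "\<alpha> \<equiv> fourier n (rotation_ind n S)" and "\<beta> \<equiv> fourier n (reflection_ind n S)"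
  shows "(\<Sum>s1\<in>S. \<Sum>s2\<in>S. dih_chi n h (s1 \<otimes>\<^bsub>dihedral_group n\<^esub> s2))
    = (\<alpha> (int h))\<^sup>2 + (\<alpha> (- int h))\<^sup>2 + 2 * (\<beta> (int h) * \<beta> (- int h))"
proof -
  let ?a = "rotation_ind n S" and ?b = "reflection_ind n S" and ?h = "int h"
  have "(\<Sum>s1\<in>S. \<Sum>s2\<in>S. dih_chi n h (s1 \<otimes>\<^bsub>dihedral_group n\<^esub> s2))
      = (\<Sum>j<n. \<Sum>k<n. ?a (int j) * ?a (int k) *
          (unity_root n (?h * int j + ?h * int k) + unity_root n (- ?h * int j + - ?h * int k)))
        + (\<Sum>j<n. \<Sum>k<n. ?b (int j) * ?b (int k) *
          (unity_root n (- ?h * int j + ?h * int k) + unity_root n (?h * int j + - ?h * int k)))"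
    by (simp add: sum_dihedral_subset[OF n S] dihedral_mult[OF n] dih_chi_rotation[OF n]
        dih_chi_reflection[OF n] sum_distrib_left mult.assoc algebra_simps)
  also have "\<dots> = \<alpha> ?h * \<alpha> ?h + \<alpha> (- ?h) * \<alpha> (- ?h) + (\<beta> (- ?h) * \<beta> ?h + \<beta> ?h * \<beta> (- ?h))"
    unfolding \<alpha>_def \<beta>_def fourier_mult by (simp only: distrib_left sum.distrib)
  finally show ?thesis by (simp add: power2_eq_square)
qed

text \<open>The linear characters correspond to the frequencies fixed by negation modulo
  \<open>n\<close>, and in each pair the sign on reflections becomes the sign of \<beta>.\<close>

lemma sum_dih_psi:
  assumes n: "n \<ge> 1" and S: "S \<subseteq> carrier (dihedral_group n)"
  defines "\<alpha> \<equiv> fourier n (rotation_ind n S)" and "\<beta> \<equiv> fourier n (reflection_ind n S)"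
  shows "(\<Sum>s\<in>S. dih_psi n 1 s) = \<alpha> 0 + \<beta> 0"
    and "(\<Sum>s\<in>S. dih_psi n 2 s) = \<alpha> 0 - \<beta> 0"
    and "even n \<Longrightarrow> (\<Sum>s\<in>S. dih_psi n 3 s) = \<alpha> (int (n div 2)) + \<beta> (int (n div 2))"
    and "even n \<Longrightarrow> (\<Sum>s\<in>S. dih_psi n 4 s) = \<alpha> (int (n div 2)) - \<beta> (int (n div 2))"
proof -
  note sum = sum_dihedral_subset[OF n S, folded dih_rot_eq_rotation dih_refl_eq_reflection]
  show "(\<Sum>s\<in>S. dih_psi n 1 s) = \<alpha> 0 + \<beta> 0" "(\<Sum>s\<in>S. dih_psi n 2 s) = \<alpha> 0 - \<beta> 0"
    unfolding sum dih_psi_1_2[OF n] by (simp_all add: \<alpha>_def \<beta>_def fourier_def sum_negf)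
  assume even: "even n"
  \<comment> \<open>At frequency \<open>n div 2\<close> the root of unity is -1, whence the
    alternating signs.\<close>
  have "unity_root n (int (n div 2)) = cis pi"
    using even n by (auto simp: unity_root_def elim!: evenE)
  then have "unity_root n (int (n div 2) * int k) = (- 1) ^ k" for k
    by (simp flip: unity_root_power)
  then show "(\<Sum>s\<in>S. dih_psi n 3 s) = \<alpha> (int (n div 2)) + \<beta> (int (n div 2))"
    "(\<Sum>s\<in>S. dih_psi n 4 s) = \<alpha> (int (n div 2)) - \<beta> (int (n div 2))"
    unfolding sum dih_psi_3_4[OF n even] by (simp_all add: \<alpha>_def \<beta>_def fourier_def sum_negf)
qed

theorem theorem2p1:
  fixes n :: nat and S :: "dihedral_gen word set set"
  assumes "n \<ge> 1"
    and "S \<subseteq> carrier (dihedral_group n) - {\<one>\<^bsub>dihedral_group n\<^esub>}"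
    and "S = set_inv\<^bsub>dihedral_group n\<^esub> S"
  shows "\<exists>\<mu>1 \<mu>2 :: nat \<Rightarrow> complex.
    graph_spectrum (cayley_graph (dihedral_group n) S) =
      (\<Sum>i = 1..(if odd n then 2 else 4). replicate_mset 1 (\<Sum>s\<in>S. dih_psi n i s))
      + (\<Sum>h = 1..(n - 1) div 2. replicate_mset 2 (\<mu>1 h) + replicate_mset 2 (\<mu>2 h)) \<and>
    (\<forall>h\<in>{1..(n - 1) div 2}.
      \<mu>1 h + \<mu>2 h = (\<Sum>s\<in>S. dih_chi n h s) \<and>
      (\<mu>1 h)\<^sup>2 + (\<mu>2 h)\<^sup>2 =
        (\<Sum>s1\<in>S. \<Sum>s2\<in>S. dih_chi n h (s1 \<otimes>\<^bsub>dihedral_group n\<^esub> s2)))"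
proof -
  let ?G = "dihedral_group n"
  define \<alpha> where "\<alpha> = fourier n (rotation_ind n S)"
  define \<beta> where "\<beta> = fourier n (reflection_ind n S)"
  \<comment> \<open>Any square root would solve the equation; a fixed function of the product makes
    \<open>r\<close> invariant under exchanging its two factors.\<close>
  define r where "r h = csqrt (\<beta> (- int h) * \<beta> (int h))" for h
  define \<mu>1 where "\<mu>1 h = \<alpha> (int h) + r h" for h
  define \<mu>2 where "\<mu>2 h = \<alpha> (int h) - r h" for h
  define M where "M h = {#\<mu>1 h, \<mu>2 h#}" for h
  note n = assms(1)
  have S: "S \<subseteq> carrier ?G" using assms(2) by blast
  have r: "r h * r h = \<beta> (- int h) * \<beta> (int h)" for h
    unfolding r_def by (simp flip: power2_eq_square)
  have \<alpha>_minus: "\<alpha> (- h) = \<alpha> h" for h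
    using fourier_reflect[of n "rotation_ind n S" h, OF n rotation_ind_mod]
    by (simp add: \<alpha>_def rotation_ind_minus[OF assms(3)])
  have period: "\<alpha> (int n + i) = \<alpha> i" "\<beta> (int n + i) = \<beta> i" for i
    using fourier_period[OF n, of _ "int n + i"] fourier_period[OF n, of _ i]
    by (simp_all add: \<alpha>_def \<beta>_def)
  \<comment> \<open>Passing from \<open>h\<close> to \<open>n - h\<close> swaps the two \<beta>
    factors under the root and leaves the even function \<alpha> unchanged.\<close>
  have M_reflect: "M (n - h) = M h" if "h < n" for h
  proof -
    have int: "int (n - h) = int n + - int h" "- int (n - h) = - int n + int h"
      using that by simp_all
    have "\<beta> (- int n + int h) = \<beta> (int h)"
      using period(2)[of "- int n + int h"] by simp
    then have "r (n - h) = r h"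
      unfolding r_def int period by (simp add: mult.commute)
    then show ?thesis
      unfolding M_def \<mu>1_def \<mu>2_def int period \<alpha>_minus by simp
  qed
  \<comment> \<open>Here \<open>r h\<close> squares to the square of \<open>\<beta> (int h)\<close>,
    so the two agree up to a sign, which the unordered pair ignores.\<close>
  have M_real: "M h = {#\<alpha> (int h) + \<beta> (int h)#} + {#\<alpha> (int h) - \<beta> (int h)#}"
    if "\<beta> (- int h) = \<beta> (int h)" for h
  proof -
    have "r h = \<beta> (int h) \<or> r h = - \<beta> (int h)"
      using r[of h] that square_eq_iff[of "r h" "\<beta> (int h)"] by simp
    then show ?thesis by (auto simp: M_def \<mu>1_def \<mu>2_def)
  qed
  note psi = sum_dih_psi[OF n S, folded \<alpha>_def \<beta>_def]
  have M0: "M 0 = {#\<Sum>s\<in>S. dih_psi n 1 s#} + {#\<Sum>s\<in>S. dih_psi n 2 s#}"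
    unfolding psi using M_real[of 0] by simp
  have Mhalf: "M (n div 2) = {#\<Sum>s\<in>S. dih_psi n 3 s#} + {#\<Sum>s\<in>S. dih_psi n 4 s#}" if "even n"
  proof -
    have "int n + - int (n div 2) = int (n div 2)"
      using that by (auto elim!: evenE)
    then have "\<beta> (- int (n div 2)) = \<beta> (int (n div 2))"
      using period(2)[of "- int (n div 2)"] by simp
    then show ?thesis unfolding psi(3,4)[OF that] by (rule M_real)
  qed
  have "graph_spectrum (cayley_graph ?G S) = (\<Sum>h<n. M h)"
    unfolding M_def \<mu>1_def \<mu>2_def \<alpha>_def
    by (rule graph_spectrum_dihedral[OF n assms(3)]) (simp add: r \<beta>_def)
  also have "\<dots> = M 0 + (if even n then M (n div 2) else 0) + (\<Sum>h = 1..(n - 1) div 2. M h + M h)"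
    by (rule sum_symmetric_residues[OF n]) (rule M_reflect)
  also have "M 0 + (if even n then M (n div 2) else 0)
      = (\<Sum>i = 1..(if odd n then 2 else 4). replicate_mset 1 (\<Sum>s\<in>S. dih_psi n i s))"
    using M0 Mhalf by (simp add: numeral_eq_Suc)
  also have "(\<Sum>h = 1..(n - 1) div 2. M h + M h)
      = (\<Sum>h = 1..(n - 1) div 2. replicate_mset 2 (\<mu>1 h) + replicate_mset 2 (\<mu>2 h))"
    by (intro sum.cong) (simp_all add: M_def numeral_2_eq_2)
  finally have spectrum: "graph_spectrum (cayley_graph ?G S)
    = (\<Sum>i = 1..(if odd n then 2 else 4). replicate_mset 1 (\<Sum>s\<in>S. dih_psi n i s))
      + (\<Sum>h = 1..(n - 1) div 2. replicate_mset 2 (\<mu>1 h) + replicate_mset 2 (\<mu>2 h))" .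
  have sums: "\<mu>1 h + \<mu>2 h = (\<Sum>s\<in>S. dih_chi n h s)" for h
    using sum_dih_chi[OF n S, of h, folded \<alpha>_def] by (simp add: \<mu>1_def \<mu>2_def \<alpha>_minus)
  \<comment> \<open>The cross terms cancel, and \<open>r h * r h\<close> is the product of the two
    \<beta> values found in the double character sum.\<close>
  have "(\<mu>1 h)\<^sup>2 + (\<mu>2 h)\<^sup>2 = 2 * (\<alpha> (int h))\<^sup>2 + 2 * (r h * r h)" for h
    by (simp add: \<mu>1_def \<mu>2_def power2_eq_square algebra_simps)
  then have squares: "(\<mu>1 h)\<^sup>2 + (\<mu>2 h)\<^sup>2 = (\<Sum>s1\<in>S. \<Sum>s2\<in>S. dih_chi n h (s1 \<otimes>\<^bsub>?G\<^esub> s2))" for h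
    by (simp add: sum_dih_chi_mult[OF n S, folded \<alpha>_def \<beta>_def] \<alpha>_minus r mult.commute)
  show ?thesis
    using spectrum sums squares by blast
qed

end
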